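(* Let $R$ be a ring, let $n$ be a positive integer, let $\sigma\colon R\to M_n(R)$ be a megainjective ring homomorphism, let $\delta\colon R\to R^n$ be a right $\sigma$-derivation and let $S=R\langle x_1,\dots,x_n;\sigma,\delta\rangle$ be the $(\sigma,\delta)$-free skew extension of $R$. Then (i) $S$ is a domain; (ii) $U(S)=U(R)$, where $U(\cdot)$ denotes the group of units; (iii) $S$ is semiprimitive, i.e. its Jacobson radical is zero.
   Context: Rings are associative with identity element; ring homomorphisms preserve the identity; modules are unital. $R^n$ denotes row vectors with $n$ entries in $R$. For a ring homomorphism $\sigma\colon R\to M_n(R)$, a right $\sigma$-derivation is an additive map $\delta\colon R\to R^n$ with $\delta(rs)=\delta(r)\sigma(s)+r\delta(s)$ for all $r,s\in R$ (matrix product in the first term). Write $\sigma_{ij}(r)$ for the $(i,j)$-entry of $\sigma(r)$ and $\delta_j(r)$ for the $j$-th component of $\delta(r)$. The $(\sigma,\delta)$-free skew extension $S=R\langle x_1,\dots,x_n;\sigma,\delta\rangle$ of $R$ is a ring (unique up to isomorphism) containing $R$ as a subring and an $n$-element subset $X=\{x_1,\dots,x_n\}$ such that (i) the submonoid $\langle X\rangle$ of the multiplicative monoid of $S$ generated by $X$ is free on $X$; (ii) $S$ is a free right $R$-module with basis $\langle X\rangle$; (iii) $rx_j=\sum_{i=1}^n x_i\sigma_{ij}(r)+\delta_j(r)$ for all $j$ and all $r\in R$. Define ring homomorphisms $\sigma^{(r)}\colon R\to M_{n^r}(R)$, $r\ge 1$, by $\sigma^{(1)}=\sigma$ and, if $\sigma^{(r)}(a)=(a_{kl})$,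 then $\sigma^{(r+1)}(a)$ is the $n^{r+1}\times n^{r+1}$ matrix whose $(k,l)$ block of size $n\times n$ is $\sigma(a_{kl})$. The homomorphism $\sigma$ is megainjective if for all $a\in R\setminus\{0\}$ and $r\ge 1$, $\sigma^{(r)}(a)$ is neither the zero matrix nor a left zero divisor in $M_{n^r}(R)$; equivalently, the columns of $\sigma^{(r)}(a)$ are right $R$-linearly independent. *)

theory Defs
  imports "Jordan_Normal_Form.Matrix"
begin

text \<open>
  The base ring is a type \<open>'r\<close> of class \<open>ring_1\<close>; \<open>M_n(R)\<close> is \<^term>\<open>carrier_mat n n\<close> and a row
  vector in \<open>R^n\<close> is an element of \<^term>\<open>carrier_mat 1 n\<close>.  Entries are indexed from 0.
\<close>

definition matrix_ring_hom :: "nat \<Rightarrow> ('r::ring_1 \<Rightarrow> 'r mat) \<Rightarrow> bool" where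
  "matrix_ring_hom n \<sigma> \<longleftrightarrow>
     (\<forall>r. \<sigma> r \<in> carrier_mat n n) \<and>
     \<sigma> 1 = 1\<^sub>m n \<and>
     (\<forall>r s. \<sigma> (r + s) = \<sigma> r + \<sigma> s) \<and>
     (\<forall>r s. \<sigma> (r * s) = \<sigma> r * \<sigma> s)"

definition right_derivation :: "nat \<Rightarrow> ('r::ring_1 \<Rightarrow> 'r mat) \<Rightarrow> ('r \<Rightarrow> 'r mat) \<Rightarrow> bool" where
  "right_derivation n \<sigma> \<delta> \<longleftrightarrow>
     (\<forall>r. \<delta> r \<in> carrier_mat 1 n) \<and>
     (\<forall>r s. \<delta> (r + s) = \<delta> r + \<delta> s) \<and>
     (\<forall>r s. \<delta> (r * s) = \<delta> r * \<sigma> s + r \<cdot>\<^sub>m \<delta> s)"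

text \<open>
  \<open>mega_iter n \<sigma> r\<close> is \<open>\<sigma>^(r)\<close> for \<open>r \<ge> 1\<close>.  The value at 0 is the usual convention
  \<open>M_1(R) = R\<close>; it is not used below.
\<close>

fun mega_iter :: "nat \<Rightarrow> ('r::ring_1 \<Rightarrow> 'r mat) \<Rightarrow> nat \<Rightarrow> 'r \<Rightarrow> 'r mat" where
  "mega_iter n \<sigma> 0 a = mat 1 1 (\<lambda>_. a)"
| "mega_iter n \<sigma> (Suc 0) a = \<sigma> a"
| "mega_iter n \<sigma> (Suc (Suc r)) a =
     mat (n ^ Suc (Suc r)) (n ^ Suc (Suc r))
       (\<lambda>(i, j). \<sigma> (mega_iter n \<sigma> (Suc r) a $$ (i div n, j div n)) $$ (i mod n, j mod n))"

definition left_zero_divisor_mat :: "nat \<Rightarrow> 'r::ring_1 mat \<Rightarrow> bool" where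
  "left_zero_divisor_mat m A \<longleftrightarrow> (\<exists>B \<in> carrier_mat m m. B \<noteq> 0\<^sub>m m m \<and> A * B = 0\<^sub>m m m)"

definition megainjective :: "nat \<Rightarrow> ('r::ring_1 \<Rightarrow> 'r mat) \<Rightarrow> bool" where
  "megainjective n \<sigma> \<longleftrightarrow>
     (\<forall>a r. a \<noteq> 0 \<longrightarrow> 1 \<le> r \<longrightarrow>
        mega_iter n \<sigma> r a \<noteq> 0\<^sub>m (n ^ r) (n ^ r) \<and>
        \<not> left_zero_divisor_mat (n ^ r) (mega_iter n \<sigma> r a))"

definition submonoid_gen :: "'s::monoid_mult set \<Rightarrow> 's set" where
  "submonoid_gen X = (\<lambda>M. 1 \<in> M \<and> (\<forall>a\<in>M. \<forall>b\<in>M. a * b \<in> M)) hull X"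

text \<open>
  The free monoid on \<open>X\<close> is \<^term>\<open>lists X\<close> under concatenation, and \<^const>\<open>prod_list\<close> is the
  canonical monoid homomorphism from it.
\<close>

definition gen_free_on :: "'s::monoid_mult set \<Rightarrow> bool" where
  "gen_free_on X \<longleftrightarrow> bij_betw prod_list (lists X) (submonoid_gen X)"

text \<open>
  Basis of the ring \<open>'s\<close> as a right module over \<open>'r\<close>, where \<open>r\<close> acts by right multiplication
  with \<open>\<iota> r\<close>.
\<close>

definition right_module_basis :: "('r::ring_1 \<Rightarrow> 's::ring_1) \<Rightarrow> 's set \<Rightarrow> bool" where
  "right_module_basis \<iota> B \<longleftrightarrow>
     (\<forall>F c. finite F \<longrightarrow> F \<subseteq> B \<longrightarrow> (\<Sum>b\<in>F. b * \<iota> (c b)) = 0 \<longrightarrow> (\<forall>b\<in>F. c b = 0)) \<and>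
     (\<forall>s. \<exists>F c. finite F \<and> F \<subseteq> B \<and> s = (\<Sum>b\<in>F. b * \<iota> (c b)))"

text \<open>
  The type \<open>'s\<close>, with \<open>'r\<close> embedded as a subring by \<open>\<iota>\<close> and with elements
  \<open>x 0, \<dots>, x (n - 1)\<close>, is the \<open>(\<sigma>,\<delta>)\<close>-free skew extension of \<open>'r\<close>.
\<close>

definition free_skew_extension ::
  "nat \<Rightarrow> ('r::ring_1 \<Rightarrow> 'r mat) \<Rightarrow> ('r \<Rightarrow> 'r mat) \<Rightarrow> ('r \<Rightarrow> 's::ring_1) \<Rightarrow> (nat \<Rightarrow> 's) \<Rightarrow> bool" where
  "free_skew_extension n \<sigma> \<delta> \<iota> x \<longleftrightarrow>
     inj_ring_hom \<iota> \<and>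
     inj_on x {..<n} \<and>
     gen_free_on (x ` {..<n}) \<and>
     right_module_basis \<iota> (submonoid_gen (x ` {..<n})) \<and>
     (\<forall>j<n. \<forall>r. \<iota> r * x j = (\<Sum>i<n. x i * \<iota> (\<sigma> r $$ (i, j))) + \<iota> (\<delta> r $$ (0, j)))"

definition ring_units :: "'a::ring_1 set" where
  "ring_units = {u. \<exists>v. u * v = 1 \<and> v * u = 1}"

definition right_ideal :: "'a::ring_1 set \<Rightarrow> bool" where
  "right_ideal I \<longleftrightarrow>
     0 \<in> I \<and> (\<forall>a\<in>I. \<forall>b\<in>I. a + b \<in> I) \<and> (\<forall>a\<in>I. \<forall>s. a * s \<in> I)"

definition maximal_right_ideal :: "'a::ring_1 set \<Rightarrow> bool" where
  "maximal_right_ideal I \<longleftrightarrow>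
     right_ideal I \<and> I \<noteq> UNIV \<and> (\<forall>J. right_ideal J \<longrightarrow> I \<subseteq> J \<longrightarrow> J = I \<or> J = UNIV)"

definition jacobson_radical :: "'a::ring_1 set" where
  "jacobson_radical = \<Inter> {I. maximal_right_ideal I}"

end

theory Submission
  imports Defs
begin

text \<open>
  Commuting a coefficient \<open>r\<close> past a word of length \<open>e\<close> produces words of length \<open>e\<close> with
  coefficients given by \<open>\<sigma>^(e) r\<close>, plus shorter words.  Hence the coefficients of the leading part
  of a product \<open>s * t\<close> are the vectors \<open>\<sigma>^(e) a * b\<close> with \<open>a\<close> a leading coefficient of \<open>s\<close> and \<open>b\<close>
  the vector of leading coefficients of \<open>t\<close>, and megainjectivity makes the degree additive.
  So there are no zero divisors and one-sided invertible elements have degree 0.  If \<open>s \<noteq> 0\<close> lay in the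
  Jacobson radical, then \<open>1 - s * x 0\<close>, which has positive degree, would be right invertible.
\<close>

section \<open>Right ideals and the Jacobson radical of an arbitrary ring\<close>

lemma right_ideal_eq_UNIV_iff: "right_ideal I \<Longrightarrow> I = UNIV \<longleftrightarrow> 1 \<in> I"
  unfolding right_ideal_def by (metis UNIV_I UNIV_eq_I mult_1)

lemma right_ideal_principal: "right_ideal (range ((*) (a :: 'a::ring_1)))"
  unfolding right_ideal_def
proof (intro conjI ballI allI)
  show "0 \<in> range ((*) a)"
    by (metis mult_zero_right rangeI)
qed (auto simp: mult.assoc simp flip: distrib_left)

lemma right_ideal_Union_chain:
  assumes "C \<noteq> {}" "\<forall>I\<in>C. right_ideal I" "\<forall>I\<in>C. \<forall>J\<in>C. I \<subseteq> J \<or> J \<subseteq> I"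
  shows "right_ideal (\<Union>C)"
  unfolding right_ideal_def
proof (intro conjI ballI allI)
  show "0 \<in> \<Union>C"
    using assms(1,2) by (auto simp: right_ideal_def)
  show "a * s \<in> \<Union>C" if "a \<in> \<Union>C" for a s
    using that assms(2) unfolding right_ideal_def by blast
  fix a b assume "a \<in> \<Union>C" "b \<in> \<Union>C"
  then obtain I J where IJ: "I \<in> C" "J \<in> C" "a \<in> I" "b \<in> J" by blast
  with assms(3) have "I \<subseteq> J \<or> J \<subseteq> I" by blast
  then show "a + b \<in> \<Union>C"
    using IJ assms(2) unfolding right_ideal_def by blast
qed

text \<open>Zorn's lemma on the right ideals above \<open>I\<close> that omit 1. Omitting 1 is the
  same as being proper, but in this form it visibly passes to unions of chains.\<close>

lemma ex_maximal_right_ideal: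
  assumes "right_ideal I" "1 \<notin> I"
  obtains M where "maximal_right_ideal M" "I \<subseteq> M"
proof -
  let ?A = "{J. right_ideal J \<and> I \<subseteq> J \<and> 1 \<notin> J}"
  have "\<exists>M\<in>?A. \<forall>X\<in>?A. M \<subseteq> X \<longrightarrow> X = M"
  proof (rule subset_Zorn_nonempty)
    show "?A \<noteq> {}" using assms by blast
    fix C assume C: "C \<noteq> {}" "subset.chain ?A C"
    then have "C \<subseteq> ?A" "\<forall>I\<in>C. \<forall>J\<in>C. I \<subseteq> J \<or> J \<subseteq> I"
      by (auto simp: subset_chain_def)
    with C(1) show "\<Union>C \<in> ?A"
      using right_ideal_Union_chain[of C] by blast
  qed
  then obtain M where "M \<in> ?A" and max: "\<forall>X\<in>?A. M \<subseteq> X \<longrightarrow> X = M" ..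
  then have M: "right_ideal M" "I \<subseteq> M" "1 \<notin> M" by auto
  have "maximal_right_ideal M"
    unfolding maximal_right_ideal_def
  proof (intro conjI allI impI)
    show "M \<noteq> UNIV" using M(3) by blast
    fix J assume J: "right_ideal J" "M \<subseteq> J"
    show "J = M \<or> J = UNIV"
      using bspec[OF max, of J] M(2) J right_ideal_eq_UNIV_iff[OF J(1)] by auto
  qed (fact M(1))
  with M(2) show ?thesis by (rule that[rotated])
qed

text \<open>If \<open>1 - s * t\<close> had no right inverse, the right ideal it generates would be
  proper, hence inside a maximal one. That ideal also contains \<open>s * t\<close>, so it would
  contain 1.\<close>

lemma jacobson_radical_right_invertible:
  assumes "s \<in> jacobson_radical"
  shows "\<exists>y. (1 - s * t) * y = 1"
proof (rule ccontr)
  assume *: "\<nexists>y. (1 - s * t) * y = 1"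
  let ?I = "range ((*) (1 - s * t))"
  have "1 \<notin> ?I" using * by (metis rangeE)
  then obtain M where M: "maximal_right_ideal M" "?I \<subseteq> M"
    using ex_maximal_right_ideal right_ideal_principal by blast
  then have ideal: "right_ideal M" and "M \<noteq> UNIV"
    by (auto simp: maximal_right_ideal_def)
  have "s \<in> M"
    using assms M(1) by (auto simp: jacobson_radical_def)
  then have "s * t \<in> M"
    using ideal by (simp add: right_ideal_def)
  moreover have "1 - s * t \<in> M"
    using M(2) by (metis mult_1_right rangeI subsetD)
  ultimately have "1 - s * t + s * t \<in> M"
    using ideal unfolding right_ideal_def by blast
  then have "1 \<in> M" by simp
  then show False
    using right_ideal_eq_UNIV_iff[OF ideal] \<open>M \<noteq> UNIV\<close> by blast
qed

lemma zero_in_jacobson_radical: "0 \<in> jacobson_radical"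
  by (auto simp: jacobson_radical_def maximal_right_ideal_def right_ideal_def)

section \<open>Index arithmetic for block matrices and the entries of \<sigma>^(e)\<close>

lemma mult_add_less_power:
  fixes k l m n :: nat
  assumes "k < m" "l < n"
  shows "k * n + l < m * n"
proof -
  have "k * n + l < Suc k * n" using assms(2) by simp
  also have "\<dots> \<le> m * n" using assms(1) by (intro mult_le_mono1) simp
  finally show ?thesis .
qed

lemma sum_mult_add_reindex:
  fixes g :: "nat \<Rightarrow> 'a::comm_monoid_add"
  assumes "0 < n"
  shows "(\<Sum>k<m. \<Sum>i<n. g (k * n + i)) = (\<Sum>K<m * n. g K)"
proof -
  have "(\<Sum>k<m. \<Sum>i<n. g (k * n + i)) = (\<Sum>(k, i)\<in>{..<m} \<times> {..<n}. g (k * n + i))"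
    by (rule sum.cartesian_product)
  also have "\<dots> = (\<Sum>K<m * n. g K)"
    by (rule sum.reindex_bij_witness[where j = "\<lambda>(k, i). k * n + i" and i = "\<lambda>K. (K div n, K mod n)"])
      (use assms in \<open>auto simp: mult_add_less_power less_mult_imp_div_less\<close>)
  finally show ?thesis .
qed

lemma mega_iter_carrier:
  assumes "matrix_ring_hom n \<sigma>"
  shows "mega_iter n \<sigma> e a \<in> carrier_mat (n ^ e) (n ^ e)"
  using assms by (cases "(n, \<sigma>, e, a)" rule: mega_iter.cases) (auto simp: matrix_ring_hom_def)

text \<open>A uniform recursion that includes the step from exponent 0 to 1: there both block
  indices are 0, and the single entry of \<open>mega_iter n \<sigma> 0 a\<close> is
  \<open>a\<close>.\<close>

lemma mega_iter_Suc_entry: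
  assumes "i < n ^ Suc e" "j < n ^ Suc e"
  shows "mega_iter n \<sigma> (Suc e) a $$ (i, j) =
    \<sigma> (mega_iter n \<sigma> e a $$ (i div n, j div n)) $$ (i mod n, j mod n)"
  using assms by (cases e) auto

locale megainjective_skew_extension =
  fixes n :: nat
    and \<sigma> :: "'r::ring_1 \<Rightarrow> 'r mat"
    and \<delta> :: "'r \<Rightarrow> 'r mat"
    and \<iota> :: "'r \<Rightarrow> 's::ring_1"
    and x :: "nat \<Rightarrow> 's"
  assumes n_pos: "0 < n"
    and sigma: "matrix_ring_hom n \<sigma>"
    and mega: "megainjective n \<sigma>"
    and ext: "free_skew_extension n \<sigma> \<delta> \<iota> x"
begin

sublocale \<iota>: inj_ring_hom \<iota>
  using ext by (simp add: free_skew_extension_def)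

section \<open>Consequences of megainjectivity for the base ring\<close>

text \<open>From \<open>a * b = 0\<close> follows \<open>\<sigma> a * \<sigma> b = 0\<close>. For
  nonzero \<open>a\<close> and \<open>b\<close> the second factor is a nonzero matrix, so the first
  would be a left zero divisor, against megainjectivity at exponent 1.\<close>

lemma base_domain:
  assumes "a * b = (0::'r)"
  shows "a = 0 \<or> b = 0"
proof (rule ccontr)
  assume "\<not> ?thesis"
  then have ab: "a \<noteq> 0" "b \<noteq> 0" by auto
  have car: "\<sigma> r \<in> carrier_mat n n" for r
    using sigma by (simp add: matrix_ring_hom_def)
  have "\<sigma> 0 + \<sigma> 0 = \<sigma> 0"
    using sigma by (metis add_0 matrix_ring_hom_def)
  then have "\<sigma> 0 = 0\<^sub>m n n"
    by (metis add_uminus_minus_mat assoc_add_mat car minus_r_inv_mat right_add_zero_mat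
        uminus_carrier_mat)
  then have "\<sigma> a * \<sigma> b = 0\<^sub>m n n"
    using sigma assms by (metis matrix_ring_hom_def)
  moreover have *: "\<sigma> r \<noteq> 0\<^sub>m n n \<and> \<not> left_zero_divisor_mat n (\<sigma> r)" if "r \<noteq> 0" for r
    using mega that unfolding megainjective_def by (metis order_refl power_one_right mega_iter.simps(2) One_nat_def)
  ultimately show False
    using *[OF ab(1)] *[OF ab(2)] car[of b] unfolding left_zero_divisor_mat_def by blast
qed

text \<open>This is the independence of the columns of \<sigma>^(e)(a). Megainjectivity speaks of
  square matrices, so the vector \<open>b\<close> is repeated in every column of \<open>?B\<close>.
  Exponent 0 lies outside its scope and is the absence of zero divisors in R.\<close>

lemma mega_iter_mult_vec_nonzero:
  assumes "a \<noteq> 0" "l0 < n ^ e" "b l0 \<noteq> 0"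
  shows "\<exists>k<n ^ e. (\<Sum>l<n ^ e. mega_iter n \<sigma> e a $$ (k, l) * b l) \<noteq> 0"
proof (cases e)
  case 0
  then show ?thesis
    using assms base_domain[of a "b 0"] by auto
next
  case (Suc e')
  let ?M = "mega_iter n \<sigma> e a" and ?B = "mat (n ^ e) (n ^ e) (\<lambda>(l, j). b l)"
  show ?thesis
  proof (rule ccontr)
    assume *: "\<not> ?thesis"
    have car: "?M \<in> carrier_mat (n ^ e) (n ^ e)"
      by (rule mega_iter_carrier[OF sigma])
    have "?M * ?B = 0\<^sub>m (n ^ e) (n ^ e)"
    proof (rule eq_matI)
      fix i j assume "i < dim_row (0\<^sub>m (n ^ e) (n ^ e) :: 'r mat)"
        "j < dim_col (0\<^sub>m (n ^ e) (n ^ e) :: 'r mat)"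
      then show "(?M * ?B) $$ (i, j) = 0\<^sub>m (n ^ e) (n ^ e) $$ (i, j)"
        using * car by (auto simp: scalar_prod_def atLeast0LessThan)
    qed (use car in auto)
    moreover have "?B \<noteq> 0\<^sub>m (n ^ e) (n ^ e)"
    proof
      assume "?B = 0\<^sub>m (n ^ e) (n ^ e)"
      then have "?B $$ (l0, l0) = 0\<^sub>m (n ^ e) (n ^ e) $$ (l0, l0)" by simp
      with assms show False by simp
    qed
    ultimately have "left_zero_divisor_mat (n ^ e) ?M"
      unfolding left_zero_divisor_mat_def by (intro bexI[of _ ?B]) auto
    then show False
      using mega assms(1) Suc unfolding megainjective_def by (metis le_add1 plus_1_eq_Suc)
  qed
qed

subsection \<open>Words\<close>

text \<open>
  A word of length \<open>e\<close> is encoded by the number below \<open>n ^ e\<close> whose base \<open>n\<close> digits are the indices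
  of its letters, the last letter being the least significant one.  This is the row and column indexing
  of \<^term>\<open>mega_iter n \<sigma> e\<close>.
\<close>

primrec letters :: "nat \<Rightarrow> nat \<Rightarrow> 's list" where
  "letters 0 k = []"
| "letters (Suc e) k = letters e (k div n) @ [x (k mod n)]"

definition word :: "nat \<Rightarrow> nat \<Rightarrow> 's" where
  "word e k = prod_list (letters e k)"

lemma word_0 [simp]: "word 0 k = 1"
  by (simp add: word_def)

lemma word_Suc: "word (Suc e) k = word e (k div n) * x (k mod n)"
  by (simp add: word_def)

lemma word_snoc: "i < n \<Longrightarrow> word e k * x i = word (Suc e) (k * n + i)"
  by (simp add: word_Suc)

lemma div_less_power: "k < n ^ Suc e \<Longrightarrow> k div n < n ^ e"
  by (rule less_mult_imp_div_less) (simp add: mult.commute)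

text \<open>Concatenation appends the \<open>f\<close> digits of \<open>l\<close> to those of
  \<open>k\<close>, which shifts \<open>k\<close> by the factor \<open>n ^ f\<close>.\<close>

lemma word_mult:
  assumes "l < n ^ f"
  shows "word e k * word f l = word (e + f) (k * n ^ f + l)"
  using assms
proof (induction f arbitrary: l)
  case (Suc f)
  have "(k * n ^ Suc f + l) div n = k * n ^ f + l div n" "(k * n ^ Suc f + l) mod n = l mod n"
    using div_mult_self3[of n "k * n ^ f" l] mod_mult_self3[of "k * n ^ f" n l] n_pos
    by (simp_all add: ac_simps)
  with Suc show ?case
    by (simp add: word_Suc div_less_power flip: mult.assoc)
qed simp

lemma letters_in_lists: "letters e k \<in> lists (x ` {..<n})"
  using n_pos by (induction e arbitrary: k) auto

lemma length_letters [simp]: "length (letters e k) = e"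
  by (induction e arbitrary: k) auto

lemma letters_inj:
  "letters e k = letters e l \<Longrightarrow> k < n ^ e \<Longrightarrow> l < n ^ e \<Longrightarrow> k = l"
proof (induction e arbitrary: k l)
  case (Suc e)
  have "inj_on x {..<n}"
    using ext by (simp add: free_skew_extension_def)
  then have "k mod n = l mod n"
    using Suc.prems(1) n_pos by (auto dest: inj_onD)
  moreover have "k div n = l div n"
    using Suc by (auto simp only: letters.simps append1_eq_conv div_less_power)
  ultimately show ?case by (metis div_mult_mod_eq)
qed simp

text \<open>Freeness turns an equality of products into an equality of letter lists. Their lengths
  give \<open>e = f\<close>, and the digits give \<open>k = l\<close>.\<close>

lemma word_inj:
  assumes "word e k = word f l" "k < n ^ e" "l < n ^ f"
  shows "e = f \<and> k = l"
proof -
  have "inj_on prod_list (lists (x ` {..<n}))"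
    using ext by (simp add: free_skew_extension_def gen_free_on_def bij_betw_def)
  then have "letters e k = letters f l"
    using assms(1) letters_in_lists unfolding word_def by (metis inj_onD)
  then show ?thesis
    using letters_inj assms(2,3) length_letters by metis
qed

lemma submonoid_gen_eq_words: "submonoid_gen (x ` {..<n}) = {word e k | e k. k < n ^ e}"
proof
  show "submonoid_gen (x ` {..<n}) \<subseteq> {word e k | e k. k < n ^ e}"
    unfolding submonoid_gen_def
  proof (rule hull_minimal)
    have "x i = word 1 i" if "i < n" for i
      using that by (simp add: word_Suc)
    then show "x ` {..<n} \<subseteq> {word e k | e k. k < n ^ e}"
      by force
    have "word e k * word f l \<in> {word e k | e k. k < n ^ e}" if "k < n ^ e" "l < n ^ f" for e k f l
      using that word_mult[of l f e k] mult_add_less_power[of k "n ^ e" l "n ^ f"]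
      unfolding power_add[symmetric] by blast
    moreover have "1 \<in> {word e k | e k. k < n ^ e}"
      by (intro CollectI exI[of _ 0]) simp
    ultimately show "1 \<in> {word e k | e k. k < n ^ e} \<and>
        (\<forall>a\<in>{word e k | e k. k < n ^ e}. \<forall>b\<in>{word e k | e k. k < n ^ e}.
          a * b \<in> {word e k | e k. k < n ^ e})"
      by blast
  qed
  have "bij_betw prod_list (lists (x ` {..<n})) (submonoid_gen (x ` {..<n}))"
    using ext by (simp add: free_skew_extension_def gen_free_on_def)
  then show "{word e k | e k. k < n ^ e} \<subseteq> submonoid_gen (x ` {..<n})"
    using letters_in_lists by (auto simp: bij_betw_def word_def)
qed

subsection \<open>The filtration by length\<close>

text \<open>The bound on the length is strict: this is the set of elements of degree less than
  \<open>e\<close>. Thus \<open>lower 0\<close> is zero and 0 needs no degree of its own.\<close>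

definition lower :: "nat \<Rightarrow> 's set" where
  "lower e = {\<Sum>f<e. \<Sum>k<n ^ f. word f k * \<iota> (c f k) | c. True}"

lemma lower_0 [simp]: "lower 0 = {0}"
  by (simp add: lower_def)

lemma lower_Suc_iff:
  "s \<in> lower (Suc e) \<longleftrightarrow> (\<exists>p\<in>lower e. \<exists>c. s = p + (\<Sum>k<n ^ e. word e k * \<iota> (c k)))"
proof
  assume "s \<in> lower (Suc e)"
  then show "\<exists>p\<in>lower e. \<exists>c. s = p + (\<Sum>k<n ^ e. word e k * \<iota> (c k))"
    unfolding lower_def by auto
next
  assume "\<exists>p\<in>lower e. \<exists>c. s = p + (\<Sum>k<n ^ e. word e k * \<iota> (c k))"
  then obtain c d where
    "s = (\<Sum>f<e. \<Sum>k<n ^ f. word f k * \<iota> (c f k)) + (\<Sum>k<n ^ e. word e k * \<iota> (d k))"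
    unfolding lower_def by auto
  then have "s = (\<Sum>f<Suc e. \<Sum>k<n ^ f. word f k * \<iota> ((c(e := d)) f k))"
    by simp
  then show "s \<in> lower (Suc e)"
    unfolding lower_def by blast
qed

lemma lower_SucI:
  "p \<in> lower e \<Longrightarrow> s = p + (\<Sum>k<n ^ e. word e k * \<iota> (c k)) \<Longrightarrow> s \<in> lower (Suc e)"
  unfolding lower_Suc_iff by blast

lemma lower_zero: "0 \<in> lower e"
  unfolding lower_def by (intro CollectI exI[of _ "\<lambda>_ _. 0"]) simp

lemma lower_add: "s \<in> lower e \<Longrightarrow> t \<in> lower e \<Longrightarrow> s + t \<in> lower e"
proof -
  assume "s \<in> lower e" "t \<in> lower e"
  then obtain c d where "s = (\<Sum>f<e. \<Sum>k<n ^ f. word f k * \<iota> (c f k))"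
    "t = (\<Sum>f<e. \<Sum>k<n ^ f. word f k * \<iota> (d f k))"
    unfolding lower_def by auto
  then have "s + t = (\<Sum>f<e. \<Sum>k<n ^ f. word f k * \<iota> (c f k + d f k))"
    by (simp add: \<iota>.hom_add distrib_left sum.distrib)
  then show ?thesis
    unfolding lower_def by auto
qed

lemma lower_mult_base: "s \<in> lower e \<Longrightarrow> s * \<iota> r \<in> lower e"
proof -
  assume "s \<in> lower e"
  then obtain c where "s = (\<Sum>f<e. \<Sum>k<n ^ f. word f k * \<iota> (c f k))"
    unfolding lower_def by auto
  then have "s * \<iota> r = (\<Sum>f<e. \<Sum>k<n ^ f. word f k * \<iota> (c f k * r))"
    by (simp add: \<iota>.hom_mult sum_distrib_right mult.assoc)
  then show ?thesis
    unfolding lower_def by auto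
qed

lemma lower_uminus: "s \<in> lower e \<Longrightarrow> - s \<in> lower e"
  using lower_mult_base[of s e "- 1"] by (simp add: \<iota>.hom_uminus)

lemma lower_diff: "s \<in> lower e \<Longrightarrow> t \<in> lower e \<Longrightarrow> s - t \<in> lower e"
  using lower_add[OF _ lower_uminus] by force

lemma lower_sum: "(\<And>i. i \<in> A \<Longrightarrow> g i \<in> lower e) \<Longrightarrow> sum g A \<in> lower e"
  by (induction A rule: infinite_finite_induct) (auto simp: lower_zero lower_add)

lemma lower_mono: "e \<le> f \<Longrightarrow> s \<in> lower e \<Longrightarrow> s \<in> lower f"
proof (induction f rule: dec_induct)
  case (step f)
  then show ?case
    by (intro lower_SucI[of s f s "\<lambda>_. 0"]) auto
qed

lemma lower_monomial:
  assumes "f < e" "k < n ^ f"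
  shows "word f k * \<iota> r \<in> lower e"
proof (rule lower_mono)
  show "Suc f \<le> e" using assms(1) by simp
  show "word f k * \<iota> r \<in> lower (Suc f)"
    by (rule lower_SucI[of 0 _ _ "\<lambda>j. if j = k then r else 0"])
      (use assms(2) in \<open>simp_all add: lower_zero if_distrib[of \<iota>] if_distrib[of "(*) _"] cong: if_cong\<close>)
qed

text \<open>Reduces closure properties of the filtration that are additive in \<open>s\<close> to
  single monomials.\<close>

lemma lower_induct [consumes 1, case_names zero add monomial]:
  assumes "s \<in> lower e" "P 0" "\<And>s t. P s \<Longrightarrow> P t \<Longrightarrow> P (s + t)"
    "\<And>f k r. f < e \<Longrightarrow> k < n ^ f \<Longrightarrow> P (word f k * \<iota> r)"
  shows "P s"
proof -
  have sumP: "P (sum g A)" if "\<And>i. i \<in> A \<Longrightarrow> P (g i)" for g and A :: "nat set"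
    using that by (induction A rule: infinite_finite_induct) (auto simp: assms(2,3))
  obtain c where "s = (\<Sum>f<e. \<Sum>k<n ^ f. word f k * \<iota> (c f k))"
    using assms(1) unfolding lower_def by auto
  then show ?thesis
    by (auto intro!: sumP assms(4))
qed

section \<open>Moving coefficients past words, and products in the filtration\<close>

lemma base_mult_letter:
  "j < n \<Longrightarrow> \<iota> r * x j = (\<Sum>i<n. x i * \<iota> (\<sigma> r $$ (i, j))) + \<iota> (\<delta> r $$ (0, j))"
  using ext by (simp add: free_skew_extension_def)

lemma monomial_mult_letter:
  assumes "j < n"
  shows "word e k * \<iota> r * x j =
    (\<Sum>i<n. word (Suc e) (k * n + i) * \<iota> (\<sigma> r $$ (i, j))) + word e k * \<iota> (\<delta> r $$ (0, j))"
  using assms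
  by (simp add: mult.assoc base_mult_letter distrib_left sum_distrib_left word_snoc[symmetric])

lemma lower_mult_letter:
  assumes "s \<in> lower e" "j < n"
  shows "s * x j \<in> lower (Suc e)"
  using assms(1)
proof (induction rule: lower_induct)
  case (monomial f k r)
  have "k * n + i < n ^ Suc f" if "i < n" for i
    using mult_add_less_power[OF monomial(2) that] by (simp add: mult.commute)
  with monomial show ?case
    unfolding monomial_mult_letter[OF assms(2)]
    by (intro lower_add lower_sum lower_monomial) auto
qed (auto simp: lower_zero lower_add distrib_right)

text \<open>Induction on the length, appending the last letter \<open>x j\<close>. Each coefficient
  c of a word of length \<open>e\<close> passes \<open>x j\<close> by the commutation rule:
  \<sigma>(c) lands on words of length e + 1, forming one block of the next iterate, while
  \<delta>(c) stays on length \<open>e\<close> and joins the lower terms.\<close>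

lemma base_mult_word:
  assumes "l < n ^ e"
  obtains p where "p \<in> lower e"
    "\<iota> r * word e l = p + (\<Sum>k<n ^ e. word e k * \<iota> (mega_iter n \<sigma> e r $$ (k, l)))"
  using assms
proof (induction e arbitrary: l thesis)
  case 0
  then show ?case by simp
next
  case (Suc e)
  define j where "j = l mod n"
  define M where "M = (\<lambda>k. mega_iter n \<sigma> e r $$ (k, l div n))"
  have j: "j < n" using n_pos by (simp add: j_def)
  obtain p where p: "p \<in> lower e" "\<iota> r * word e (l div n) = p + (\<Sum>k<n ^ e. word e k * \<iota> (M k))"
    using Suc.IH[of "l div n"] div_less_power[OF Suc.prems(2)] unfolding M_def by blast
  define q where "q = p * x j + (\<Sum>k<n ^ e. word e k * \<iota> (\<delta> (M k) $$ (0, j)))"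
  have "q \<in> lower (Suc e)"
    unfolding q_def using p(1) j by (auto intro!: lower_add lower_sum lower_monomial lower_mult_letter)
  moreover have "\<iota> r * word (Suc e) l =
      q + (\<Sum>k<n ^ Suc e. word (Suc e) k * \<iota> (mega_iter n \<sigma> (Suc e) r $$ (k, l)))"
  proof -
    have "\<iota> r * word (Suc e) l = \<iota> r * word e (l div n) * x j"
      by (simp add: word_Suc j_def mult.assoc)
    also have "\<dots> = p * x j + (\<Sum>k<n ^ e. word e k * \<iota> (M k) * x j)"
      unfolding p(2) by (simp add: distrib_right sum_distrib_right)
    also have "\<dots> = q + (\<Sum>k<n ^ e. \<Sum>i<n. word (Suc e) (k * n + i) * \<iota> (\<sigma> (M k) $$ (i, j)))"
      unfolding q_def monomial_mult_letter[OF j] sum.distrib by (simp add: ac_simps)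
    \<comment> \<open>Writing k and i as quotient and remainder of \<open>k * n + i\<close> makes
      the summand a function of this one index, so that the double sum can be merged.\<close>
    also have "(\<Sum>k<n ^ e. \<Sum>i<n. word (Suc e) (k * n + i) * \<iota> (\<sigma> (M k) $$ (i, j))) =
        (\<Sum>k<n ^ e. \<Sum>i<n. word (Suc e) (k * n + i) *
          \<iota> (\<sigma> (M ((k * n + i) div n)) $$ ((k * n + i) mod n, j)))"
      by (intro sum.cong refl) simp
    also have "\<dots> = (\<Sum>K<n ^ e * n. word (Suc e) K * \<iota> (\<sigma> (M (K div n)) $$ (K mod n, j)))"
      by (rule sum_mult_add_reindex[OF n_pos])
    also have "\<dots> = (\<Sum>K<n ^ Suc e. word (Suc e) K * \<iota> (mega_iter n \<sigma> (Suc e) r $$ (K, l)))"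
      by (rule sum.cong)
        (use Suc.prems(2) in \<open>simp_all add: mega_iter_Suc_entry M_def j_def mult.commute
          del: mega_iter.simps\<close>)
    finally show ?thesis .
  qed
  ultimately show ?case by (rule Suc.prems(1))
qed

lemma word_mult_lower:
  assumes "s \<in> lower e" "k < n ^ d"
  shows "word d k * s \<in> lower (d + e)"
  using assms(1)
proof (induction rule: lower_induct)
  case (monomial f l r)
  have "k * n ^ f + l < n ^ (d + f)"
    using mult_add_less_power[OF assms(2) monomial(2)] by (simp add: power_add)
  with monomial show ?case
    by (auto simp: word_mult intro!: lower_monomial simp flip: mult.assoc)
qed (auto simp: lower_zero lower_add distrib_left)

lemma base_mult_lower:
  assumes "s \<in> lower e"
  shows "\<iota> r * s \<in> lower e"
  using assms
proof (induction rule: lower_induct)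
  case (monomial f l c)
  obtain p where p: "p \<in> lower f"
    "\<iota> r * word f l = p + (\<Sum>k<n ^ f. word f k * \<iota> (mega_iter n \<sigma> f r $$ (k, l)))"
    using base_mult_word[OF monomial(2)] by blast
  have "\<iota> r * word f l \<in> lower (Suc f)"
    using p by (rule lower_SucI)
  then have "\<iota> r * word f l * \<iota> c \<in> lower e"
    using monomial(1) by (intro lower_mult_base) (auto intro: lower_mono[rotated])
  then show ?case by (simp add: mult.assoc)
qed (auto simp: lower_zero lower_add distrib_left)

text \<open>Degrees at most d - 1 and e - 1 add up to at most d + e - 2, that is, less than d - 1 +
  e. For \<open>d = 0\<close> the subtraction truncates, harmlessly, since then
  \<open>s = 0\<close>.\<close>

lemma lower_mult:
  assumes "s \<in> lower d" "t \<in> lower e"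
  shows "s * t \<in> lower (d - 1 + e)"
  using assms(1)
proof (induction rule: lower_induct)
  case (monomial f k r)
  have "word f k * (\<iota> r * t) \<in> lower (f + e)"
    by (intro word_mult_lower base_mult_lower assms(2) monomial(2))
  then show ?case
    using monomial(1) by (auto simp: mult.assoc intro: lower_mono[rotated])
qed (auto simp: lower_zero lower_add distrib_right)

section \<open>The two halves of the basis property: the filtration exhausts S, and leading
  coefficients are unique\<close>

lemma ex_lower: "\<exists>e. s \<in> lower e"
proof -
  have "\<exists>F c. finite F \<and> F \<subseteq> submonoid_gen (x ` {..<n}) \<and> s = (\<Sum>b\<in>F. b * \<iota> (c b))"
    using ext by (simp add: free_skew_extension_def right_module_basis_def)
  then obtain F c where F: "finite F" "F \<subseteq> submonoid_gen (x ` {..<n})"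
    and s: "s = (\<Sum>b\<in>F. b * \<iota> (c b))"
    by (elim exE conjE)
  have "\<exists>e. (\<Sum>b\<in>F. b * \<iota> (c b)) \<in> lower e"
    using F
  proof (induction rule: finite_induct)
    case (insert b F)
    then obtain e where e: "(\<Sum>b\<in>F. b * \<iota> (c b)) \<in> lower e" by auto
    from insert.prems obtain f k where b: "b = word f k" "k < n ^ f"
      unfolding submonoid_gen_eq_words by auto
    have "b * \<iota> (c b) \<in> lower (max e (Suc f))"
      unfolding b(1) by (rule lower_monomial) (use b in auto)
    then have "(\<Sum>b\<in>insert b F. b * \<iota> (c b)) \<in> lower (max e (Suc f))"
      using insert.hyps lower_mono[OF max.cobounded1 e] by (auto intro: lower_add)
    then show ?case ..
  qed (use lower_zero in auto)
  with s show ?thesis by simp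
qed

lemma leading_coeff_unique:
  assumes "p \<in> lower e" "p + (\<Sum>k<n ^ e. word e k * \<iota> (c k)) = 0" "k < n ^ e"
  shows "c k = 0"
proof -
  obtain d where p: "p = (\<Sum>f<e. \<Sum>k<n ^ f. word f k * \<iota> (d f k))"
    using assms(1) unfolding lower_def by auto
  let ?I = "Sigma {..e} (\<lambda>f. {..<n ^ f})"
  let ?w = "\<lambda>(f, k). word f k"
  let ?g = "\<lambda>(f, k). (d(e := c)) f k"
  have inj: "inj_on ?w ?I"
    using word_inj by (auto simp: inj_on_def)
  have sub: "?w ` ?I \<subseteq> submonoid_gen (x ` {..<n})"
    unfolding submonoid_gen_eq_words by auto
  \<comment> \<open>The basis property takes coefficients indexed by basis elements. As distinct
    pairs (length, index) give distinct words, the inverse of \<open>?w\<close> recovers the pair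
    from the word. The function \<open>d(e := c)\<close> joins the lower and the leading
    coefficients.\<close>
  have "(\<Sum>b\<in>?w ` ?I. b * \<iota> (?g (the_inv_into ?I ?w b))) = (\<Sum>i\<in>?I. ?w i * \<iota> (?g i))"
    by (subst sum.reindex[OF inj])
      (auto intro!: sum.cong simp: the_inv_into_f_f[OF inj, of "(_, _)", simplified])
  also have "\<dots> = (\<Sum>f\<le>e. \<Sum>k<n ^ f. word f k * \<iota> ((d(e := c)) f k))"
    by (subst sum.Sigma) (auto intro!: sum.cong)
  also have "\<dots> = 0"
    using assms(2) unfolding p by (simp flip: lessThan_Suc_atMost)
  finally have zero: "(\<Sum>b\<in>?w ` ?I. b * \<iota> (?g (the_inv_into ?I ?w b))) = 0" .
  have "\<forall>F c. finite F \<longrightarrow> F \<subseteq> submonoid_gen (x ` {..<n}) \<longrightarrow> (\<Sum>b\<in>F. b * \<iota> (c b)) = 0 \<longrightarrow>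
      (\<forall>b\<in>F. c b = 0)"
    using ext unfolding free_skew_extension_def right_module_basis_def by (elim conjE)
  from this[rule_format, OF _ sub zero] have "?g (the_inv_into ?I ?w b) = 0" if "b \<in> ?w ` ?I" for b
    using that by simp
  moreover have "(e, k) \<in> ?I" using assms(3) by simp
  ultimately have "?g (the_inv_into ?I ?w (?w (e, k))) = 0" by blast
  then have "?g (e, k) = 0"
    unfolding the_inv_into_f_f[OF inj \<open>(e, k) \<in> ?I\<close>] .
  then show ?thesis by simp
qed

subsection \<open>Degree\<close>

definition has_degree :: "nat \<Rightarrow> 's \<Rightarrow> bool" where
  "has_degree e s \<longleftrightarrow>
     (\<exists>p\<in>lower e. \<exists>c. s = p + (\<Sum>k<n ^ e. word e k * \<iota> (c k)) \<and> (\<exists>k<n ^ e. c k \<noteq> 0))"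

lemma has_degree_in_lower: "has_degree e s \<Longrightarrow> s \<in> lower (Suc e)"
  unfolding has_degree_def lower_Suc_iff by blast

lemma has_degree_not_in_lower: "has_degree e s \<Longrightarrow> s \<notin> lower e"
proof
  assume "has_degree e s" "s \<in> lower e"
  then obtain p c k where p: "p \<in> lower e" and s: "s = p + (\<Sum>k<n ^ e. word e k * \<iota> (c k))"
    and k: "k < n ^ e" "c k \<noteq> 0"
    unfolding has_degree_def by blast
  have "(p - s) + (\<Sum>k<n ^ e. word e k * \<iota> (c k)) = 0"
    using s by simp
  with leading_coeff_unique[OF lower_diff[OF p \<open>s \<in> lower e\<close>]] k show False by blast
qed

text \<open>With this description, uniqueness of the degree follows from monotonicity of the
  filtration, and existence from taking the least \<open>e\<close> with \<open>s\<close> in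
  \<open>lower e\<close>.\<close>

lemma has_degree_iff: "has_degree e s \<longleftrightarrow> s \<in> lower (Suc e) \<and> s \<notin> lower e"
proof
  assume *: "s \<in> lower (Suc e) \<and> s \<notin> lower e"
  then obtain p c where p: "p \<in> lower e" and s: "s = p + (\<Sum>k<n ^ e. word e k * \<iota> (c k))"
    unfolding lower_Suc_iff by blast
  have "\<exists>k<n ^ e. c k \<noteq> 0"
  proof (rule ccontr)
    assume "\<not> ?thesis"
    then have "s = p" using s by simp
    with p * show False by simp
  qed
  with p s show "has_degree e s"
    unfolding has_degree_def by blast
qed (use has_degree_in_lower has_degree_not_in_lower in blast)

lemma has_degree_unique: "has_degree d s \<Longrightarrow> has_degree e s \<Longrightarrow> d = e"
  unfolding has_degree_iff by (metis Suc_leI lower_mono nat_neq_iff)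

lemma not_has_degree_zero: "\<not> has_degree e 0"
  by (simp add: has_degree_iff lower_zero)

lemma ex_has_degree:
  assumes "s \<noteq> 0"
  shows "\<exists>e. has_degree e s"
proof -
  define e where "e = (LEAST e. s \<in> lower e)"
  have e: "s \<in> lower e"
    unfolding e_def by (rule LeastI_ex) (rule ex_lower)
  with assms obtain d where "e = Suc d"
    by (cases e) auto
  moreover have "s \<notin> lower d" if "d < e" for d
    using not_less_Least that unfolding e_def by blast
  ultimately show ?thesis
    using e by (auto simp: has_degree_iff)
qed

lemma has_degree_0_iff: "has_degree 0 s \<longleftrightarrow> s \<noteq> 0 \<and> s \<in> range \<iota>"
  unfolding has_degree_iff lower_Suc_iff by auto

lemma has_degree_letter: "i < n \<Longrightarrow> has_degree 1 (x i)"
proof -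
  assume i: "i < n"
  then have "x i = 0 + (\<Sum>k<n ^ 1. word 1 k * \<iota> (if k = i then 1 else 0))"
    by (simp add: if_distrib[of \<iota>] if_distrib[of "(*) _"] word_Suc cong: if_cong)
  then show ?thesis
    unfolding has_degree_def using lower_zero i by (intro bexI[of _ 0] exI conjI) auto
qed

text \<open>With leading parts \<open>?A\<close>, \<open>?B\<close> and lower parts
  \<open>p\<close>, \<open>q\<close>, the terms \<open>p * t\<close> and \<open>?A * q\<close> have
  degree below d + e. In \<open>?A * ?B\<close>, moving each \<open>a k\<close> past the words of
  \<open>?B\<close> leaves a remainder \<open>R\<close> of lower degree and the leading coefficients
  \<open>C\<close>.\<close>

lemma has_degree_mult:
  assumes "has_degree d s" "has_degree e t"
  shows "has_degree (d + e) (s * t)"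
proof -
  obtain p a k0 where p: "p \<in> lower d" and s: "s = p + (\<Sum>k<n ^ d. word d k * \<iota> (a k))"
    and k0: "k0 < n ^ d" "a k0 \<noteq> 0"
    using assms(1) unfolding has_degree_def by blast
  obtain q b l0 where q: "q \<in> lower e" and t: "t = q + (\<Sum>l<n ^ e. word e l * \<iota> (b l))"
    and l0: "l0 < n ^ e" "b l0 \<noteq> 0"
    using assms(2) unfolding has_degree_def by blast
  let ?A = "\<Sum>k<n ^ d. word d k * \<iota> (a k)" and ?B = "\<Sum>l<n ^ e. word e l * \<iota> (b l)"
  define M where "M = (\<lambda>k m l. mega_iter n \<sigma> e (a k) $$ (m, l))"
  \<comment> \<open>The index \<open>K\<close> of a word of length d + e splits into its first d
    digits k and its last e digits m; its coefficient is entry m of \<sigma>^(e)(a k) times the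
    column \<open>b\<close>.\<close>
  define C where "C = (\<lambda>K. \<Sum>l<n ^ e. M (K div n ^ e) (K mod n ^ e) l * b l)"
  \<comment> \<open>Defining the lower terms of \<open>base_mult_word\<close> as a difference gives
    them as a function of k and l without any choice.\<close>
  define r where "r = (\<lambda>k l. \<iota> (a k) * word e l - (\<Sum>m<n ^ e. word e m * \<iota> (M k m l)))"
  have r: "r k l \<in> lower e" if l: "l < n ^ e" for k l
  proof -
    obtain p where "p \<in> lower e"
      "\<iota> (a k) * word e l = p + (\<Sum>m<n ^ e. word e m * \<iota> (mega_iter n \<sigma> e (a k) $$ (m, l)))"
      using base_mult_word[OF l] by blast
    then show ?thesis by (simp add: r_def M_def)
  qed
  have eq: "\<iota> (a k) * word e l = r k l + (\<Sum>m<n ^ e. word e m * \<iota> (M k m l))" for k l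
    by (simp add: r_def)
  define R where "R = (\<Sum>k<n ^ d. word d k * (\<Sum>l<n ^ e. r k l * \<iota> (b l)))"
  have R: "R \<in> lower (d + e)"
    unfolding R_def using r by (auto intro!: lower_sum word_mult_lower lower_mult_base)
  have coeff: "\<iota> (a k) * ?B = (\<Sum>l<n ^ e. r k l * \<iota> (b l)) +
      (\<Sum>m<n ^ e. word e m * \<iota> (\<Sum>l<n ^ e. M k m l * b l))" for k
  proof -
    have "\<iota> (a k) * ?B = (\<Sum>l<n ^ e. \<iota> (a k) * word e l * \<iota> (b l))"
      by (simp add: sum_distrib_left mult.assoc)
    also have "\<dots> = (\<Sum>l<n ^ e. r k l * \<iota> (b l) + (\<Sum>m<n ^ e. word e m * \<iota> (M k m l * b l)))"
      by (intro sum.cong refl)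
        (simp add: eq distrib_right sum_distrib_right \<iota>.hom_mult mult.assoc)
    also have "\<dots> = (\<Sum>l<n ^ e. r k l * \<iota> (b l)) +
        (\<Sum>m<n ^ e. \<Sum>l<n ^ e. word e m * \<iota> (M k m l * b l))"
      unfolding sum.distrib by (subst (2) sum.swap) (rule refl)
    finally show ?thesis
      by (simp add: \<iota>.hom_sum sum_distrib_left)
  qed
  have "?A * ?B = (\<Sum>k<n ^ d. word d k * (\<iota> (a k) * ?B))"
    by (simp add: sum_distrib_right mult.assoc)
  also have "\<dots> = R + (\<Sum>k<n ^ d. \<Sum>m<n ^ e. word d k * word e m * \<iota> (\<Sum>l<n ^ e. M k m l * b l))"
    unfolding coeff R_def distrib_left sum.distrib by (simp add: sum_distrib_left mult.assoc)
  also have "(\<Sum>k<n ^ d. \<Sum>m<n ^ e. word d k * word e m * \<iota> (\<Sum>l<n ^ e. M k m l * b l)) =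
      (\<Sum>k<n ^ d. \<Sum>m<n ^ e. word (d + e) (k * n ^ e + m) * \<iota> (C (k * n ^ e + m)))"
    by (intro sum.cong refl) (use n_pos in \<open>simp add: word_mult C_def\<close>)
  also have "\<dots> = (\<Sum>K<n ^ (d + e). word (d + e) K * \<iota> (C K))"
    unfolding power_add by (rule sum_mult_add_reindex) (use n_pos in simp)
  finally have AB: "?A * ?B = R + (\<Sum>K<n ^ (d + e). word (d + e) K * \<iota> (C K))" .
  have A: "?A \<in> lower (Suc d)"
    by (intro lower_sum lower_monomial) auto
  have "p * t \<in> lower (d + e)"
  \<comment> \<open>For \<open>d = 0\<close> the general bound on products would only give degree at
    most \<open>e\<close>, one too many; but then \<open>p = 0\<close>.\<close>
  proof (cases d)
    case 0
    then show ?thesis using p by (simp add: lower_zero)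
  next
    case (Suc d')
    then show ?thesis
      using lower_mult[OF p has_degree_in_lower[OF assms(2)]] by simp
  qed
  moreover have "?A * q \<in> lower (d + e)"
    using lower_mult[OF A q] by simp
  ultimately have low: "p * t + ?A * q + R \<in> lower (d + e)"
    using R by (intro lower_add)
  have st: "s * t = (p * t + ?A * q + R) + (\<Sum>K<n ^ (d + e). word (d + e) K * \<iota> (C K))"
  proof -
    have "s * t = p * t + ?A * t" unfolding s by (rule distrib_right)
    also have "?A * t = ?A * q + ?A * ?B" unfolding t by (rule distrib_left)
    finally show ?thesis unfolding AB by (simp add: add.assoc)
  qed
  \<comment> \<open>Block \<open>k0\<close> of \<open>C\<close> is \<sigma>^(e)(a k0) applied to the
    nonzero vector \<open>b\<close>, so no cancellation can kill the whole block.\<close>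
  obtain m where m: "m < n ^ e" "(\<Sum>l<n ^ e. M k0 m l * b l) \<noteq> 0"
    using mega_iter_mult_vec_nonzero[of "a k0" l0 e b, OF k0(2) l0] unfolding M_def by blast
  have "C (k0 * n ^ e + m) \<noteq> 0"
    using m n_pos by (simp add: C_def)
  moreover have "k0 * n ^ e + m < n ^ (d + e)"
    unfolding power_add using k0(1) m(1) by (rule mult_add_less_power)
  ultimately show ?thesis
    unfolding has_degree_def using low st by blast
qed

section \<open>Zero divisors, units and the Jacobson radical of S\<close>

lemma no_zero_divisors:
  assumes "s * t = (0::'s)"
  shows "s = 0 \<or> t = 0"
  using assms ex_has_degree has_degree_mult not_has_degree_zero by metis

lemma has_degree_one: "has_degree 0 1"
  unfolding has_degree_0_iff using \<iota>.hom_one by (metis rangeI zero_neq_one)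

lemma mult_eq_one_degree:
  assumes "s * t = (1::'s)"
  shows "has_degree 0 s" "has_degree 0 t"
proof -
  have "s \<noteq> 0" "t \<noteq> 0" using assms by auto
  then obtain d e where de: "has_degree d s" "has_degree e t"
    using ex_has_degree by metis
  then have "d + e = 0"
    using has_degree_mult[of d s e t] assms by (auto dest: has_degree_unique[OF has_degree_one])
  with de show "has_degree 0 s" "has_degree 0 t" by auto
qed

lemma ring_units_eq: "(ring_units :: 's set) = \<iota> ` ring_units"
proof (intro equalityI subsetI)
  fix u :: 's assume "u \<in> ring_units"
  then obtain v where uv: "u * v = 1" "v * u = 1"
    by (auto simp: ring_units_def)
  \<comment> \<open>Both factors of 1 have degree 0, so the inverse lies in R as well, and
    injectivity of \<iota> transfers the two equations to R.\<close>
  then obtain a b where ab: "u = \<iota> a" "v = \<iota> b"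
    using mult_eq_one_degree has_degree_0_iff by (metis rangeE)
  have "\<iota> (a * b) = \<iota> 1" "\<iota> (b * a) = \<iota> 1"
    using uv ab by (simp_all add: \<iota>.hom_mult)
  then have "a \<in> ring_units"
    unfolding ring_units_def by auto
  with ab show "u \<in> \<iota> ` ring_units" by blast
next
  fix u :: 's assume "u \<in> \<iota> ` ring_units"
  then obtain a b where u: "u = \<iota> a" and ab: "a * b = 1" "b * a = 1"
    by (auto simp: ring_units_def)
  have "\<iota> a * \<iota> b = 1" "\<iota> b * \<iota> a = 1"
    using ab by (simp_all flip: \<iota>.hom_mult)
  then show "u \<in> ring_units"
    unfolding u ring_units_def by blast
qed

lemma jacobson_radical_eq_zero: "(jacobson_radical :: 's set) = {0}"
proof -
  have "s = 0" if s: "s \<in> jacobson_radical" for s :: 's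
  proof (rule ccontr)
    assume "s \<noteq> 0"
    then obtain d where "has_degree d s" using ex_has_degree by blast
    \<comment> \<open>The extra letter forces positive degree even when \<open>s\<close> is a
      constant; \<open>x 0\<close> is available because n is positive.\<close>
    then have deg: "has_degree (Suc d) (s * x 0)"
      using has_degree_mult has_degree_letter[OF n_pos] by fastforce
    obtain y where "(1 - s * x 0) * y = 1"
      using jacobson_radical_right_invertible[OF s] by blast
    \<comment> \<open>Right invertibility forces degree 0. Since 1 also has degree 0, so small a
      difference would put \<open>s * x 0\<close> in \<open>lower 1\<close>.\<close>
    then have "1 - s * x 0 \<in> lower 1"
      using mult_eq_one_degree has_degree_in_lower by fastforce
    moreover have "1 \<in> lower 1"
      using has_degree_in_lower[OF has_degree_one] by simp
    ultimately have "1 - (1 - s * x 0) \<in> lower 1"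
      by (rule lower_diff[rotated])
    then have "s * x 0 \<in> lower 1" by simp
    then have "s * x 0 \<in> lower (Suc d)"
      by (rule lower_mono[rotated]) simp
    with deg show False by (simp add: has_degree_iff)
  qed
  then show ?thesis
    using zero_in_jacobson_radical by blast
qed

end

theorem corollary3p7:
  fixes n :: nat
    and \<sigma> :: "'r::ring_1 \<Rightarrow> 'r mat"
    and \<delta> :: "'r \<Rightarrow> 'r mat"
    and \<iota> :: "'r \<Rightarrow> 's::ring_1"
    and x :: "nat \<Rightarrow> 's"
  assumes "0 < n"
    and "matrix_ring_hom n \<sigma>"
    and "megainjective n \<sigma>"
    and "right_derivation n \<sigma> \<delta>"
    and "free_skew_extension n \<sigma> \<delta> \<iota> x"
  shows "((1::'s) \<noteq> 0 \<and> (\<forall>a b :: 's. a * b = 0 \<longrightarrow> a = 0 \<or> b = 0)) \<and>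
         (ring_units :: 's set) = \<iota> ` ring_units \<and>
         (jacobson_radical :: 's set) = {0}"
proof -
  interpret megainjective_skew_extension n \<sigma> \<delta> \<iota> x
    by unfold_locales (fact assms)+
  show ?thesis
    using no_zero_divisors ring_units_eq jacobson_radical_eq_zero by auto
qed

end
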